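(* Let $n\ge1$ and $s\in\{0,1,\ldots,n-1\}$. Generically, all local minimizers of SCNO are nondegenerate with vanishing M-index. That is, the set of all $f\in C^2(\mathbb{R}^n,\mathbb{R})$ such that every local minimizer of $f$ on $\mathbb{R}^{n,s}$ is a nondegenerate M-stationary point with M-index equal to zero is $C^2_s$-generic.
   Context: For $x\in\mathbb{R}^n$, $\|x\|_0$ is the number of non-zero entries of $x$, and $\mathbb{R}^{n,s}=\{x\in\mathbb{R}^n : \|x\|_0\le s\}$. SCNO is the problem $\min f(x)$ s.t. $x\in\mathbb{R}^{n,s}$. For $x\in\mathbb{R}^{n,s}$ put $I_0(x)=\{i: x_i=0\}$ and $I_1(x)=\{i: x_i\neq 0\}$. A point $\bar x\in\mathbb{R}^{n,s}$ is M-stationary if $\frac{\partial f}{\partial x_i}(\bar x)=0$ for all $i\in I_1(\bar x)$. An M-stationary point $\bar x$ with $\|\bar x\|_0=k$ is nondegenerate if: (ND1) if $k<s$ then $\frac{\partial f}{\partial x_i}(\bar x)\ne0$ for all $i\in I_0(\bar x)$; and (ND2) the matrix $\left(\frac{\partial^2 f}{\partial x_i\partial x_j}(\bar x)\right)_{i,j\in I_1(\bar x)}$ is nonsingular. The quadratic index $QI$ of a nondegenerate M-stationary point is the number of negative eigenvalues of the matrix in ND2, and its M-index is $s-k+QI$. The $C^2_s$-topology is the strong (Whitney) $C^2$-topology on $C^2(\mathbb{R}^n,\mathbb{R})$: a neighborhood base of $f$ consists of the sets of all $g$ such that the function value, all first-order and all second-order partial derivatives of $g-f$ at $x$ are bounded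 in absolute value by $\varepsilon(x)$ for every $x\in\mathbb{R}^n$ (strict inequality), where $\varepsilon:\mathbb{R}^n\to(0,\infty)$ ranges over continuous positive functions. A subset of $C^2(\mathbb{R}^n,\mathbb{R})$ is $C^2_s$-generic if it contains a countable intersection of $C^2_s$-open and $C^2_s$-dense subsets. *)

theory Defs
  imports
    "Jordan_Normal_Form.Char_Poly"
    "HOL-Analysis.Analysis"
begin

no_notation Matrix.vec_index (infixl "$" 100)
no_notation Congruence.eq_closure_of ("closure'_of\<index>")
no_notation Matrix.scalar_prod (infix "\<bullet>" 70)

definition norm0 :: "real ^ 'n \<Rightarrow> nat" where
  "norm0 x = card {i. x $ i \<noteq> 0}"

definition sparse_vectors :: "nat \<Rightarrow> (real ^ 'n) set" where
  "sparse_vectors s = {x. norm0 x \<le> s}"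

definition I0 :: "real ^ 'n \<Rightarrow> 'n set" where
  "I0 x = {i. x $ i = 0}"

definition I1 :: "real ^ 'n \<Rightarrow> 'n set" where
  "I1 x = {i. x $ i \<noteq> 0}"

definition local_minimizer_on :: "('a::topological_space \<Rightarrow> real) \<Rightarrow> 'a set \<Rightarrow> 'a \<Rightarrow> bool" where
  "local_minimizer_on f S x \<longleftrightarrow>
     x \<in> S \<and> (\<exists>U. open U \<and> x \<in> U \<and> (\<forall>y \<in> S \<inter> U. f x \<le> f y))"

definition partial :: "'n \<Rightarrow> (real ^ 'n \<Rightarrow> real) \<Rightarrow> real ^ 'n \<Rightarrow> real" where
  "partial i f x = deriv (\<lambda>t. f (x + t *\<^sub>R axis i 1)) 0"

lemma partial_eq_frechet_derivative:
  fixes f :: "real ^ 'n \<Rightarrow> real"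
  assumes "f differentiable (at x)"
  shows "partial i f x = frechet_derivative f (at x) (axis i 1)"
proof -
  let ?D = "frechet_derivative f (at x)"
  have D: "(f has_derivative ?D) (at x)"
    using assms by (simp add: frechet_derivative_works)
  have "((\<lambda>t::real. x + t *\<^sub>R axis i 1) has_derivative (\<lambda>t. t *\<^sub>R axis i 1)) (at 0)"
    by (auto intro!: derivative_eq_intros)
  moreover have "(f has_derivative ?D) (at (x + (0::real) *\<^sub>R axis i 1))"
    using D by simp
  ultimately have "((\<lambda>t. f (x + t *\<^sub>R axis i 1)) has_derivative
      (\<lambda>t. ?D (t *\<^sub>R axis i 1))) (at 0)"
    by (rule has_derivative_compose)
  moreover have "?D (t *\<^sub>R axis i 1) = ?D (axis i 1) * t" for t
    unfolding linear_cmul[OF has_derivative_linear[OF D]] by simp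
  ultimately have "((\<lambda>t. f (x + t *\<^sub>R axis i 1)) has_field_derivative ?D (axis i 1)) (at 0)"
    by (simp add: has_field_derivative_def)
  then show ?thesis
    unfolding partial_def by (rule DERIV_imp_deriv)
qed

definition C1 :: "(real ^ 'n \<Rightarrow> real) set" where
  "C1 = {f. (\<forall>x. f differentiable (at x)) \<and> (\<forall>i. continuous_on UNIV (partial i f))}"

definition C2 :: "(real ^ 'n \<Rightarrow> real) set" where
  "C2 = {f \<in> C1. \<forall>i. partial i f \<in> C1}"

definition M_stationary :: "(real ^ 'n \<Rightarrow> real) \<Rightarrow> nat \<Rightarrow> real ^ 'n \<Rightarrow> bool" where
  "M_stationary f s x \<longleftrightarrow> x \<in> sparse_vectors s \<and> (\<forall>i \<in> I1 x. partial i f x = 0)"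

text \<open>The index type carries no order, so the rows and columns of the Hessian block indexed by
  \<^term>\<open>I1 x\<close> are arranged along an arbitrary enumeration. Another enumeration conjugates the
  block by a permutation matrix, which changes neither its determinant nor its characteristic
  polynomial.\<close>

definition enum_I1 :: "real ^ 'n \<Rightarrow> 'n list" where
  "enum_I1 x = (SOME is. distinct is \<and> set is = I1 x)"

lemma enum_I1: "distinct (enum_I1 x)" "set (enum_I1 x) = I1 x"
  and length_enum_I1: "length (enum_I1 x) = norm0 x"
proof -
  have "\<exists>is. distinct is \<and> set is = I1 x"
    using finite_distinct_list[of "I1 x"] by auto
  then have *: "distinct (enum_I1 x) \<and> set (enum_I1 x) = I1 x"
    unfolding enum_I1_def by (rule someI_ex)
  then show "distinct (enum_I1 x)" "set (enum_I1 x) = I1 x"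
    by auto
  then show "length (enum_I1 x) = norm0 x"
    using distinct_card[of "enum_I1 x"] by (simp add: norm0_def I1_def)
qed

definition hessian_I1 :: "(real ^ 'n \<Rightarrow> real) \<Rightarrow> real ^ 'n \<Rightarrow> real Matrix.mat" where
  "hessian_I1 f x = Matrix.mat (norm0 x) (norm0 x)
     (\<lambda>(a, b). partial (enum_I1 x ! a) (partial (enum_I1 x ! b) f) x)"

definition nondegenerate_M_stationary ::
    "(real ^ 'n \<Rightarrow> real) \<Rightarrow> nat \<Rightarrow> real ^ 'n \<Rightarrow> bool" where
  "nondegenerate_M_stationary f s x \<longleftrightarrow>
     M_stationary f s x \<and>
     (norm0 x < s \<longrightarrow> (\<forall>i \<in> I0 x. partial i f x \<noteq> 0)) \<and>
     Determinant.det (hessian_I1 f x) \<noteq> 0"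

text \<open>Negative eigenvalues are counted with algebraic multiplicity; this is also their geometric
  multiplicity, the Hessian of a \<^term>\<open>C2\<close> function being symmetric.\<close>

definition quadratic_index :: "(real ^ 'n \<Rightarrow> real) \<Rightarrow> real ^ 'n \<Rightarrow> nat" where
  "quadratic_index f x =
     (\<Sum>\<mu> | \<mu> < 0 \<and> eigenvalue (hessian_I1 f x) \<mu>. order \<mu> (char_poly (hessian_I1 f x)))"

text \<open>The subtraction is not truncated at points of \<^term>\<open>sparse_vectors s\<close>.\<close>

definition M_index :: "(real ^ 'n \<Rightarrow> real) \<Rightarrow> nat \<Rightarrow> real ^ 'n \<Rightarrow> nat" where
  "M_index f s x = (s - norm0 x) + quadratic_index f x"

definition C2s_nbhd ::
    "(real ^ 'n \<Rightarrow> real) \<Rightarrow> (real ^ 'n \<Rightarrow> real) \<Rightarrow> (real ^ 'n \<Rightarrow> real) set" where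
  "C2s_nbhd \<epsilon> f = {g \<in> C2. \<forall>x. \<bar>g x - f x\<bar> < \<epsilon> x \<and>
     (\<forall>i. \<bar>partial i g x - partial i f x\<bar> < \<epsilon> x) \<and>
     (\<forall>i j. \<bar>partial i (partial j g) x - partial i (partial j f) x\<bar> < \<epsilon> x)}"

definition C2s_topology :: "(real ^ 'n \<Rightarrow> real) topology" where
  "C2s_topology = topology (\<lambda>U. U \<subseteq> C2 \<and>
     (\<forall>f \<in> U. \<exists>\<epsilon>. continuous_on UNIV \<epsilon> \<and> (\<forall>x. 0 < \<epsilon> x) \<and> C2s_nbhd \<epsilon> f \<subseteq> U))"

lemma openin_C2s_topology:
  fixes U :: "(real ^ 'n \<Rightarrow> real) set"
  shows "openin C2s_topology U \<longleftrightarrow> U \<subseteq> C2 \<and>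
     (\<forall>f \<in> U. \<exists>\<epsilon>. continuous_on UNIV \<epsilon> \<and> (\<forall>x. 0 < \<epsilon> x) \<and> C2s_nbhd \<epsilon> f \<subseteq> U)"
proof -
  let ?P = "\<lambda>(f :: real ^ 'n \<Rightarrow> real) (U :: (real ^ 'n \<Rightarrow> real) set) (\<epsilon> :: real ^ 'n \<Rightarrow> real).
    continuous_on UNIV \<epsilon> \<and> (\<forall>x. 0 < \<epsilon> x) \<and> C2s_nbhd \<epsilon> f \<subseteq> U"
  let ?open = "\<lambda>U. U \<subseteq> C2 \<and> (\<forall>f \<in> U. \<exists>\<epsilon>. ?P f U \<epsilon>)"
  have Int: "?open (S \<inter> T)" if S: "?open S" and T: "?open T"
    for S T :: "(real ^ 'n \<Rightarrow> real) set"
  proof (intro conjI ballI)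
    show "S \<inter> T \<subseteq> C2" using conjunct1[OF S] by blast
    fix f assume "f \<in> S \<inter> T"
    then have "f \<in> S" "f \<in> T" by simp_all
    obtain \<epsilon> where \<epsilon>: "continuous_on UNIV \<epsilon>" "\<forall>x. 0 < \<epsilon> x" "C2s_nbhd \<epsilon> f \<subseteq> S"
      using bspec[OF conjunct2[OF S] \<open>f \<in> S\<close>] by blast
    obtain \<delta> where \<delta>: "continuous_on UNIV \<delta>" "\<forall>x. 0 < \<delta> x" "C2s_nbhd \<delta> f \<subseteq> T"
      using bspec[OF conjunct2[OF T] \<open>f \<in> T\<close>] by blast
    have "C2s_nbhd (\<lambda>x. min (\<epsilon> x) (\<delta> x)) f \<subseteq> C2s_nbhd \<epsilon> f \<inter> C2s_nbhd \<delta> f"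
      by (simp add: C2s_nbhd_def subset_eq)
    also have "\<dots> \<subseteq> S \<inter> T"
      by (rule Int_mono[OF \<epsilon>(3) \<delta>(3)])
    finally have "?P f (S \<inter> T) (\<lambda>x. min (\<epsilon> x) (\<delta> x))"
      using continuous_on_min[OF \<epsilon>(1) \<delta>(1)] \<epsilon>(2) \<delta>(2) by simp
    then show "\<exists>\<epsilon>. ?P f (S \<inter> T) \<epsilon>" by (rule exI[where P = "?P f (S \<inter> T)"])
  qed
  have Un: "?open (\<Union>\<K>)" if \<K>: "\<forall>K \<in> \<K>. ?open K"
    for \<K> :: "(real ^ 'n \<Rightarrow> real) set set"
  proof (intro conjI ballI)
    show "\<Union>\<K> \<subseteq> C2"
      by (rule Union_least) (rule conjunct1[OF bspec[OF \<K>]])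
    fix f assume "f \<in> \<Union>\<K>"
    then obtain K where K: "K \<in> \<K>" "f \<in> K" by (rule UnionE)
    obtain \<epsilon> where \<epsilon>: "?P f K \<epsilon>"
      using bspec[OF conjunct2[OF bspec[OF \<K> K(1)]] K(2)] by (rule exE)
    then have "?P f (\<Union>\<K>) \<epsilon>"
      using subset_trans[OF _ Union_upper[OF K(1)]] by simp
    then show "\<exists>\<epsilon>. ?P f (\<Union>\<K>) \<epsilon>" by (rule exI[where P = "?P f (\<Union>\<K>)"])
  qed
  have "istopology ?open"
    unfolding istopology_def
  proof (rule conjI)
    show "\<forall>S T. ?open S \<longrightarrow> ?open T \<longrightarrow> ?open (S \<inter> T)"
      by (rule allI, rule allI, rule impI, rule impI, rule Int)
    show "\<forall>\<K>. (\<forall>K \<in> \<K>. ?open K) \<longrightarrow> ?open (\<Union>\<K>)"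
      by (rule allI, rule impI, rule Un)
  qed
  then show ?thesis
    unfolding C2s_topology_def by (subst topology_inverse') (assumption, rule refl)
qed

lemma topspace_C2s_topology:
  "topspace (C2s_topology :: (real ^ 'n \<Rightarrow> real) topology) = C2"
proof
  have "openin C2s_topology (C2 :: (real ^ 'n \<Rightarrow> real) set)"
    unfolding openin_C2s_topology
  proof (intro conjI ballI exI)
    show "C2s_nbhd (\<lambda>_. 1) f \<subseteq> C2" for f :: "real ^ 'n \<Rightarrow> real"
      by (simp add: C2s_nbhd_def)
  qed simp_all
  then show "(C2 :: (real ^ 'n \<Rightarrow> real) set) \<subseteq> topspace C2s_topology"
    by (rule openin_subset)
  show "topspace C2s_topology \<subseteq> (C2 :: (real ^ 'n \<Rightarrow> real) set)"
    using openin_topspace[of C2s_topology] unfolding openin_C2s_topology by (rule conjunct1)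
qed

lemma openin_C2s_nbhd:
  fixes f :: "real ^ 'n \<Rightarrow> real"
  assumes f: "f \<in> C2" and \<epsilon>: "continuous_on UNIV \<epsilon>"
  shows "openin C2s_topology (C2s_nbhd \<epsilon> f)"
  unfolding openin_C2s_topology
proof (intro conjI ballI)
  show "C2s_nbhd \<epsilon> f \<subseteq> C2" by (auto simp: C2s_nbhd_def)
  fix g assume g: "g \<in> C2s_nbhd \<epsilon> f"
  then have "g \<in> C2" by (simp add: C2s_nbhd_def)
  have c0: "continuous_on UNIV h" if "h \<in> C1" for h :: "real ^ 'n \<Rightarrow> real"
  proof (rule continuous_at_imp_continuous_on, rule ballI)
    fix x
    have "h differentiable (at x)" using that unfolding C1_def by blast
    then show "isCont h x" by (rule differentiable_imp_continuous_within)
  qed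
  have c1: "continuous_on UNIV (partial i h)" if "h \<in> C1" for h :: "real ^ 'n \<Rightarrow> real" and i
    using that unfolding C1_def by blast
  have C2D: "h \<in> C1" "partial i h \<in> C1" if "h \<in> C2" for h :: "real ^ 'n \<Rightarrow> real" and i
    using that unfolding C2_def by blast+
  note c = c0[OF C2D(1)] c1[OF C2D(1)] c1[OF C2D(2)]
  define \<delta> where "\<delta> x = \<epsilon> x - (max \<bar>g x - f x\<bar>
     (max (Max (range (\<lambda>i. \<bar>partial i g x - partial i f x\<bar>)))
       (Max (range (\<lambda>p. \<bar>partial (fst p) (partial (snd p) g) x
          - partial (fst p) (partial (snd p) f) x\<bar>)))))" for x
  have contMax: "continuous_on UNIV (\<lambda>x. Max (range (\<lambda>i. h i x)))"
    if "\<And>i. continuous_on UNIV (h i)" for h :: "'k::finite \<Rightarrow> real ^ 'n \<Rightarrow> real"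
  proof -
    have "continuous_on UNIV (\<lambda>x. Max ((\<lambda>i. h i x) ` A))" if "finite A" "A \<noteq> {}" for A
      using that
    proof (induction rule: finite_ne_induct)
      case (singleton a)
      then show ?case using \<open>\<And>i. continuous_on UNIV (h i)\<close> by simp
    next
      case (insert a A)
      then show ?case using \<open>\<And>i. continuous_on UNIV (h i)\<close>
        by (simp add: continuous_on_max)
    qed
    then show ?thesis by simp
  qed
  have "continuous_on UNIV \<delta>"
    unfolding \<delta>_def
    by (rule continuous_on_diff[OF \<epsilon>] continuous_on_max contMax continuous_on_rabs
        continuous_on_diff c f \<open>g \<in> C2\<close>)+
  moreover have "0 < \<delta> x" for x
    using g by (auto simp: \<delta>_def C2s_nbhd_def)
  moreover have "C2s_nbhd \<delta> g \<subseteq> C2s_nbhd \<epsilon> f"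
  proof
    fix h assume h: "h \<in> C2s_nbhd \<delta> g"
    have 1: "\<delta> x \<le> \<epsilon> x - \<bar>g x - f x\<bar>" for x
      by (simp add: \<delta>_def)
    let ?M1 = "\<lambda>x i. \<bar>partial i g x - partial i f x\<bar>"
    let ?M2 = "\<lambda>x p. \<bar>partial (fst p) (partial (snd p) g) x
          - partial (fst p) (partial (snd p) f) x\<bar>"
    have M1: "?M1 x i \<le> Max (range (?M1 x))" for x i
      by (rule Max_ge[OF finite_imageI[OF finite] rangeI])
    have 2: "\<delta> x \<le> \<epsilon> x - \<bar>partial i g x - partial i f x\<bar>" for i x
      using M1[of i x] unfolding \<delta>_def by linarith
    have M2: "?M2 x p \<le> Max (range (?M2 x))" for x p
      by (rule Max_ge[OF finite_imageI[OF finite] rangeI])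
    have 3: "\<delta> x \<le> \<epsilon> x - \<bar>partial i (partial j g) x - partial i (partial j f) x\<bar>" for i j x
      using M2[of "(i, j)" x] unfolding \<delta>_def fst_conv snd_conv by linarith
    from h have h': "h \<in> C2" "\<And>x. \<bar>h x - g x\<bar> < \<delta> x"
      "\<And>i x. \<bar>partial i h x - partial i g x\<bar> < \<delta> x"
      "\<And>i j x. \<bar>partial i (partial j h) x - partial i (partial j g) x\<bar> < \<delta> x"
      by (auto simp: C2s_nbhd_def)
    have "\<bar>h x - f x\<bar> < \<epsilon> x" for x
      using 1[of x] h'(2)[of x] by linarith
    moreover have "\<bar>partial i h x - partial i f x\<bar> < \<epsilon> x" for i x
      using 2[of x i] h'(3)[of i x] by linarith
    moreover have "\<bar>partial i (partial j h) x - partial i (partial j f) x\<bar> < \<epsilon> x" for i j x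
      using 3[of x i j] h'(4)[of i j x] by linarith
    ultimately show "h \<in> C2s_nbhd \<epsilon> f"
      using h'(1) by (simp add: C2s_nbhd_def)
  qed
  ultimately show "\<exists>\<delta>. continuous_on UNIV \<delta> \<and> (\<forall>x. 0 < \<delta> x) \<and> C2s_nbhd \<delta> g \<subseteq> C2s_nbhd \<epsilon> f"
    by blast
qed

definition generic_in :: "'a topology \<Rightarrow> 'a set \<Rightarrow> bool" where
  "generic_in X G \<longleftrightarrow> G \<subseteq> topspace X \<and>
     (\<exists>U :: nat \<Rightarrow> 'a set. (\<forall>m. openin X (U m) \<and> X closure_of (U m) = topspace X) \<and>
        (\<Inter>m. U m) \<subseteq> G)"

end

theory Submission
  imports Defs
begin

text \<open>For each radius \<open>m\<close> ask that, on the ball of radius \<open>m\<close>, the gradient of \<open>f\<close> has no zero at a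
  point with a vanishing coordinate, and that the restriction of \<open>f\<close> to every coordinate subspace is
  Morse. Each condition is open by compactness. It is dense because \<open>f\<close> may be perturbed by a small
  linear form \<open>c \<bullet> x\<close>, cut off outside the ball, with \<open>- c\<close> outside finitely many null sets: the image
  of the coordinate hyperplanes under the \<open>C\<^sup>1\<close> gradient, and critical values supplied by Sard's
  theorem. If all conditions hold, let \<open>x\<close> be a local minimizer on the sparse vectors. When
  \<open>norm0 x < s\<close>, every coordinate direction is feasible, so the whole gradient vanishes at \<open>x\<close>, although
  \<open>s < n\<close> forces a zero coordinate: this is excluded. So \<open>norm0 x = s\<close>, and \<open>x\<close> is a local minimizer on
  the coordinate subspace of its support; its Hessian there is positive semidefinite and, by the Morse
  condition, nonsingular.\<close>

section \<open>Calculus of partial derivatives\<close>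

text \<open>The partials come out as equations between functions, not only at a point, so that
  iterated partials can be obtained by rewriting. The closure rules for \<open>C1\<close> rest on
  this.\<close>

lemma C1I:
  fixes f :: "real ^ 'n \<Rightarrow> real"
  assumes der: "\<And>x. (f has_derivative (\<lambda>h. \<Sum>i\<in>UNIV. h $ i * D i x)) (at x)"
    and cont: "\<And>i. continuous_on UNIV (D i)"
  shows "f \<in> C1" and "partial i f = D i"
proof -
  have diff: "f differentiable (at x)" for x
    using der[of x] unfolding differentiable_def by blast
  have *: "partial i f = D i" for i
  proof
    fix x
    have "partial i f x = (\<Sum>j\<in>UNIV. axis i 1 $ j * D j x)"
      unfolding partial_eq_frechet_derivative[OF diff] frechet_derivative_at[OF der, symmetric] ..
    also have "\<dots> = (\<Sum>j\<in>UNIV. if j = i then D j x else 0)"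
      by (rule sum.cong) (auto simp: axis_def)
    finally show "partial i f x = D i x" by simp
  qed
  then show "partial i f = D i" by simp
  show "f \<in> C1" unfolding C1_def using diff cont by (auto simp: *)
qed

lemma C1_has_derivative:
  fixes f :: "real ^ 'n \<Rightarrow> real"
  assumes "f \<in> C1"
  shows "(f has_derivative (\<lambda>h. \<Sum>i\<in>UNIV. h $ i * partial i f x)) (at x)"
proof -
  let ?D = "frechet_derivative f (at x)"
  have diff: "f differentiable (at x)" using assms unfolding C1_def by blast
  then have D: "(f has_derivative ?D) (at x)" by (simp add: frechet_derivative_works)
  then have lin: "linear ?D" by (rule has_derivative_linear)
  have "?D h = (\<Sum>i\<in>UNIV. h $ i * partial i f x)" for h
  proof -
    have "?D h = ?D (\<Sum>i\<in>UNIV. h $ i *\<^sub>R axis i 1)"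
      using basis_expansion[of h] by (simp add: scalar_mult_eq_scaleR)
    also have "\<dots> = (\<Sum>i\<in>UNIV. h $ i * ?D (axis i 1))"
      by (simp add: linear_sum[OF lin] linear_cmul[OF lin])
    finally show ?thesis by (simp add: partial_eq_frechet_derivative[OF diff])
  qed
  then show ?thesis using D by presburger
qed

lemma C1_continuous: "f \<in> C1 \<Longrightarrow> continuous_on S f"
  by (intro continuous_at_imp_continuous_on ballI has_derivative_continuous[OF C1_has_derivative])

lemma C1_continuous_partial: "f \<in> C1 \<Longrightarrow> continuous_on S (partial i f)"
  unfolding C1_def using continuous_on_subset by blast

lemma C1_const: "(\<lambda>x. a) \<in> C1" and partial_const: "partial i (\<lambda>x. a) = (\<lambda>x. 0)"
  using C1I[of "\<lambda>x. a" "\<lambda>_ _. 0"] by simp_all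

lemma C1_nth: "(\<lambda>x :: real ^ 'n. x $ k) \<in> C1"
  and partial_nth: "partial i (\<lambda>x :: real ^ 'n. x $ k) = (\<lambda>x. if i = k then 1 else 0)"
proof -
  have "((\<lambda>x. x $ k) has_derivative (\<lambda>h. \<Sum>i\<in>UNIV. h $ i * (if i = k then 1 else 0))) (at x)"
    for x :: "real ^ 'n"
    by (auto intro!: derivative_eq_intros bounded_linear.has_derivative[OF bounded_linear_vec_nth] simp: if_distrib cong: if_cong)
  from C1I[where D = "\<lambda>i x. if i = k then 1 else 0", OF this]
  show "(\<lambda>x :: real ^ 'n. x $ k) \<in> C1" "partial i (\<lambda>x :: real ^ 'n. x $ k) = (\<lambda>x. if i = k then 1 else 0)"
    by simp_all
qed

lemma C1_add: "(\<lambda>x. f x + g x) \<in> C1"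
  and partial_add: "partial i (\<lambda>x. f x + g x) = (\<lambda>x. partial i f x + partial i g x)"
  if "f \<in> C1" "g \<in> C1"
proof -
  have "((\<lambda>x. f x + g x) has_derivative
      (\<lambda>h. \<Sum>i\<in>UNIV. h $ i * (partial i f x + partial i g x))) (at x)" for x
    using has_derivative_add[OF C1_has_derivative[OF that(1)] C1_has_derivative[OF that(2)]]
    by (simp add: algebra_simps sum.distrib)
  from C1I[where D = "\<lambda>i x. partial i f x + partial i g x", OF this]
  show "(\<lambda>x. f x + g x) \<in> C1"
    "partial i (\<lambda>x. f x + g x) = (\<lambda>x. partial i f x + partial i g x)"
    by (simp_all add: continuous_on_add C1_continuous_partial that)
qed

lemma C1_mult: "(\<lambda>x. f x * g x) \<in> C1"
  and partial_mult: "partial i (\<lambda>x. f x * g x) = (\<lambda>x. partial i f x * g x + f x * partial i g x)"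
  if "f \<in> C1" "g \<in> C1"
proof -
  have "((\<lambda>x. f x * g x) has_derivative
      (\<lambda>h. \<Sum>i\<in>UNIV. h $ i * (partial i f x * g x + f x * partial i g x))) (at x)" for x
    using has_derivative_mult[OF C1_has_derivative[OF that(1)] C1_has_derivative[OF that(2)]]
    by (simp add: algebra_simps sum.distrib sum_distrib_left)
  from C1I[where D = "\<lambda>i x. partial i f x * g x + f x * partial i g x", OF this]
  show "(\<lambda>x. f x * g x) \<in> C1"
    "partial i (\<lambda>x. f x * g x) = (\<lambda>x. partial i f x * g x + f x * partial i g x)"
    by (simp_all add: continuous_on_add continuous_on_mult C1_continuous_partial C1_continuous that)
qed

lemma C1_compose: "(\<lambda>x. q (f x)) \<in> C1"
  and partial_compose: "partial i (\<lambda>x. q (f x)) = (\<lambda>x. q' (f x) * partial i f x)"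
  if "f \<in> C1" and q: "\<And>t. (q has_real_derivative q' t) (at t)" and q': "continuous_on UNIV q'"
proof -
  have "((\<lambda>x. q (f x)) has_derivative
      (\<lambda>h. \<Sum>i\<in>UNIV. h $ i * (q' (f x) * partial i f x))) (at x)" for x
    using has_derivative_compose[OF C1_has_derivative[OF that(1)] q[unfolded has_field_derivative_def]]
    by (simp add: algebra_simps sum_distrib_left)
  from C1I[where D = "\<lambda>i x. q' (f x) * partial i f x", OF this]
  show "(\<lambda>x. q (f x)) \<in> C1" "partial i (\<lambda>x. q (f x)) = (\<lambda>x. q' (f x) * partial i f x)"
    by (simp_all add: continuous_on_mult C1_continuous_partial that(1)
        continuous_on_compose2[OF q' C1_continuous])
qed

lemma C1_sum: "(\<lambda>x. \<Sum>k\<in>A. f k x) \<in> C1"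
  and partial_sum: "partial i (\<lambda>x. \<Sum>k\<in>A. f k x) = (\<lambda>x. \<Sum>k\<in>A. partial i (f k) x)"
  if "\<And>k. f k \<in> C1"
proof -
  have "(\<lambda>x. \<Sum>k\<in>A. f k x) \<in> C1 \<and>
      partial i (\<lambda>x. \<Sum>k\<in>A. f k x) = (\<lambda>x. \<Sum>k\<in>A. partial i (f k) x)"
    by (induction A rule: infinite_finite_induct)
      (simp_all add: C1_const partial_const C1_add partial_add that)
  then show "(\<lambda>x. \<Sum>k\<in>A. f k x) \<in> C1"
    "partial i (\<lambda>x. \<Sum>k\<in>A. f k x) = (\<lambda>x. \<Sum>k\<in>A. partial i (f k) x)" by simp_all
qed

section \<open>Closure properties of the class \<open>C2\<close>\<close>

lemma C2_imp_C1: "f \<in> C2 \<Longrightarrow> f \<in> C1" and C2_partial: "f \<in> C2 \<Longrightarrow> partial i f \<in> C1"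
  by (simp_all add: C2_def)

lemma C2_const: "(\<lambda>x. a) \<in> C2"
  by (simp add: C2_def C1_const partial_const)

lemma C2_nth: "(\<lambda>x. x $ k) \<in> C2"
  by (simp add: C2_def C1_const C1_nth partial_nth)

lemma C2_add: "f \<in> C2 \<Longrightarrow> g \<in> C2 \<Longrightarrow> (\<lambda>x. f x + g x) \<in> C2"
  by (simp add: C2_def C1_add partial_add)

lemma C2_mult: "f \<in> C2 \<Longrightarrow> g \<in> C2 \<Longrightarrow> (\<lambda>x. f x * g x) \<in> C2"
  by (simp add: C2_def C1_add C1_mult partial_mult)

lemma C2_sum: "(\<And>k. f k \<in> C2) \<Longrightarrow> (\<lambda>x. \<Sum>k\<in>A. f k x) \<in> C2"
  by (simp add: C2_def C1_sum partial_sum)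

lemma C2_compose:
  assumes f: "f \<in> C2" and q: "\<And>t. (q has_real_derivative q' t) (at t)"
    and q': "\<And>t. (q' has_real_derivative q'' t) (at t)" and q'': "continuous_on UNIV q''"
  shows "(\<lambda>x. q (f x)) \<in> C2"
proof -
  have "continuous_on UNIV q'"
    using q' DERIV_isCont continuous_at_imp_continuous_on by blast
  note q = q this
  show ?thesis
    using f unfolding C2_def
    by (simp add: C1_compose[OF _ q] partial_compose[OF _ q] C1_mult C1_compose[OF _ q' q''])
qed

text \<open>A partial derivative sees only a short segment around \<open>x\<close>. This lets a
  cut-off function be differentiated as a constant on any open set where it is constant.\<close>

lemma partial_cong_open:
  fixes f g :: "real ^ 'n \<Rightarrow> real"
  assumes S: "open S" "x \<in> S" and eq: "\<And>y. y \<in> S \<Longrightarrow> f y = g y"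
  shows "partial i f x = partial i g x"
  unfolding partial_def
proof (rule deriv_cong_ev)
  have "open ((\<lambda>t::real. x + t *\<^sub>R axis i 1) -` S)"
    by (intro open_vimage S continuous_intros)
  then have "\<forall>\<^sub>F t in nhds 0. t \<in> (\<lambda>t::real. x + t *\<^sub>R axis i 1) -` S"
    by (rule eventually_nhds_in_open) (simp add: S)
  then show "\<forall>\<^sub>F t in nhds 0. f (x + t *\<^sub>R axis i 1) = g (x + t *\<^sub>R axis i 1)"
    by (rule eventually_mono) (simp add: eq)
qed simp

section \<open>Cut-off functions of class \<open>C2\<close>\<close>

lemma DERIV_pos_part_power:
  "((\<lambda>t::real. max 0 t ^ Suc (Suc k)) has_real_derivative of_nat (Suc (Suc k)) * max 0 t ^ Suc k) (at t)"
proof -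
  consider "t < 0" | "t = 0" | "t > 0" by linarith
  then show ?thesis
  proof cases
    case 1
    have "((\<lambda>t::real. 0) has_real_derivative 0) (at t)" by simp
    then have "((\<lambda>t::real. max 0 t ^ Suc (Suc k)) has_real_derivative 0) (at t)"
      by (rule DERIV_cong_ev[THEN iffD1, OF refl _ refl, rotated])
        (use 1 in \<open>auto intro!: eventually_mono[OF eventually_nhds_in_open[of "{..<0}"]]\<close>)
    then show ?thesis using 1 by simp
  next
    \<comment> \<open>At the corner Caratheodory's form of the derivative applies: the slope
      function \<open>max 0 z ^ Suc k\<close> is continuous and vanishes at 0. This is where the
      exponent has to be at least two.\<close>
    case 2
    have "max 0 z ^ Suc (Suc k) - max 0 t ^ Suc (Suc k) = max 0 z ^ Suc k * (z - t)" for z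
      using 2 by (simp add: max_def)
    moreover have "isCont (\<lambda>z::real. max 0 z ^ Suc k) t" by (intro continuous_intros)
    ultimately show ?thesis
      unfolding CARAT_DERIV using 2 by (intro exI[of _ "\<lambda>z::real. max 0 z ^ Suc k"]) simp
  next
    case 3
    have "((\<lambda>t::real. t ^ Suc (Suc k)) has_real_derivative of_nat (Suc (Suc k)) * t ^ Suc k) (at t)"
      using DERIV_pow[of "Suc (Suc k)" t] by simp
    then have "((\<lambda>t::real. max 0 t ^ Suc (Suc k)) has_real_derivative of_nat (Suc (Suc k)) * t ^ Suc k) (at t)"
      by (rule DERIV_cong_ev[THEN iffD1, OF refl _ refl, rotated])
        (use 3 in \<open>auto intro!: eventually_mono[OF eventually_nhds_in_open[of "{0<..}"]]\<close>)
    then show ?thesis using 3 by simp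
  qed
qed

text \<open>Three is the least integer exponent for which the second derivative of the power of the
  positive part, here \<open>6 * max 0 t\<close>, is continuous.\<close>

lemma C2_pos_part_cube: "f \<in> C2 \<Longrightarrow> (\<lambda>x. max 0 (f x) ^ 3) \<in> C2"
proof (erule C2_compose)
  show "((\<lambda>t::real. max 0 t ^ 3) has_real_derivative 3 * max 0 t ^ 2) (at t)" for t
    using DERIV_pos_part_power[of 1 t] by (simp add: numeral_3_eq_3 numeral_2_eq_2)
  show "((\<lambda>t::real. 3 * max 0 t ^ 2) has_real_derivative 3 * (2 * max 0 t)) (at t)" for t
    using DERIV_cmult[OF DERIV_pos_part_power[of 0 t], of 3] by (simp add: numeral_2_eq_2)
qed (intro continuous_intros)

lemma C2_bump:
  obtains \<beta> :: "real ^ 'n \<Rightarrow> real" and R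
  where "\<beta> \<in> C2" "\<And>x. norm x < r \<Longrightarrow> \<beta> x = 1" "\<And>x. norm x > R \<Longrightarrow> \<beta> x = 0"
proof
  \<comment> \<open>The squared norm is used because it is a polynomial. The inner cube vanishes on
    the ball of radius \<open>r\<close> and is at least 1 once the squared norm exceeds
    \<open>r\<^sup>2 + 1\<close>, where the outer positive part becomes 0. Hence \<open>R\<close> is
    \<open>sqrt (r\<^sup>2 + 1)\<close>.\<close>
  let ?\<beta> = "\<lambda>x::real^'n. max 0 (1 + (-1) * max 0 ((\<Sum>i\<in>UNIV. x $ i * x $ i) + (- r\<^sup>2)) ^ 3) ^ 3"
  have n: "(\<Sum>i\<in>UNIV. x $ i * x $ i) = (norm x)\<^sup>2" for x :: "real ^ 'n"
    by (simp add: norm_eq_sqrt_inner inner_vec_def sum_nonneg)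
  show "?\<beta> \<in> C2"
    by (intro C2_pos_part_cube C2_add C2_mult C2_const C2_sum C2_nth)
  show "?\<beta> x = 1" if "norm x < r" for x
    using that power_mono[of "norm x" r 2] by (simp add: n max_absorb1)
  show "?\<beta> x = 0" if "norm x > sqrt (r\<^sup>2 + 1)" for x
  proof -
    have "r\<^sup>2 + 1 < (norm x)\<^sup>2"
      using that real_le_rsqrt[of "norm x" "r\<^sup>2 + 1"] by linarith
    then have "1 \<le> ((norm x)\<^sup>2 - r\<^sup>2) ^ 3" by (intro one_le_power) simp
    moreover have "max 0 ((norm x)\<^sup>2 - r\<^sup>2) = (norm x)\<^sup>2 - r\<^sup>2" using \<open>r\<^sup>2 + 1 < (norm x)\<^sup>2\<close> by simp
    ultimately show ?thesis by (simp add: n)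
  qed
qed

section \<open>Sard's theorem over a finite index type\<close>

text \<open>The library states Sard's theorem only for spaces \<open>real ^ 'n\<close> with a well-ordered index type;
  the copy \<open>'a ordered\<close> of a finite type carries the order of an arbitrary enumeration.\<close>

typedef ('a::finite) ordered = "UNIV :: 'a set" by simp

instance ordered :: (finite) finite
proof
  have "range Abs_ordered = (UNIV :: 'a ordered set)"
    using type_definition.Abs_image[OF type_definition_ordered] by simp
  then show "finite (UNIV :: 'a ordered set)" using finite_imageI[OF finite] by metis
qed

instantiation ordered :: (finite) wellorder
begin

definition less_eq_ordered :: "'a ordered \<Rightarrow> 'a ordered \<Rightarrow> bool" where
  "x \<le> y \<longleftrightarrow> to_nat_on UNIV (Rep_ordered x) \<le> to_nat_on UNIV (Rep_ordered y)"

definition less_ordered :: "'a ordered \<Rightarrow> 'a ordered \<Rightarrow> bool" where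
  "x < y \<longleftrightarrow> to_nat_on UNIV (Rep_ordered x) < to_nat_on UNIV (Rep_ordered y)"

instance
proof
  fix x y z :: "'a ordered"
  have "x = y" if "to_nat_on UNIV (Rep_ordered x) = to_nat_on UNIV (Rep_ordered y)"
    using injD[OF inj_on_to_nat_on[OF countable_finite[OF finite]] that] by (simp add: Rep_ordered_inject)
  then show "x \<le> y \<Longrightarrow> y \<le> x \<Longrightarrow> x = y"
    unfolding less_eq_ordered_def by (metis le_antisym)
  fix P :: "'a ordered \<Rightarrow> bool"
  assume "\<And>x. (\<And>y. y < x \<Longrightarrow> P y) \<Longrightarrow> P x"
  then show "P z"
    unfolding less_ordered_def by (rule measure_induct_rule[of "\<lambda>x. to_nat_on UNIV (Rep_ordered x)"])
qed (auto simp: less_eq_ordered_def less_ordered_def)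

end

lemma bij_Rep_ordered: "bij (Rep_ordered :: 'a::finite ordered \<Rightarrow> 'a)"
  using type_definition.Rep_range[OF type_definition_ordered]
  by (simp add: bij_def inj_def Rep_ordered_inject)

lemma card_ordered: "CARD('a::finite ordered) = CARD('a)"
  by (rule bij_betw_same_card[OF bij_Rep_ordered])

text \<open>The relabelling \<open>T\<close> of coordinates carries the claim to a well-ordered
  index type. There a kernel vector makes the Jacobian rank-deficient, so Sard's theorem applies,
  and the linear map \<open>T'\<close> between spaces of equal dimension carries the null set
  back.\<close>

lemma negligible_critical_values:
  fixes f :: "real ^ 'n \<Rightarrow> real ^ 'n"
  assumes der: "\<And>x. x \<in> S \<Longrightarrow> (f has_derivative f' x) (at x)"
    and sing: "\<And>x. x \<in> S \<Longrightarrow> \<exists>v. v \<noteq> 0 \<and> f' x v = 0"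
  shows "negligible (f ` S)"
proof -
  define T :: "real ^ 'n \<Rightarrow> real ^ 'n ordered" where "T x = (\<chi> i. x $ Rep_ordered i)" for x
  define T' :: "real ^ 'n ordered \<Rightarrow> real ^ 'n" where "T' x = (\<chi> i. x $ Abs_ordered i)" for x
  have T'T [simp]: "T' (T x) = x" and TT' [simp]: "T (T' y) = y" for x y
    by (simp_all add: T_def T'_def vec_eq_iff Abs_ordered_inverse Rep_ordered_inverse)
  have lin: "linear T" "linear T'"
    by (auto intro!: linearI simp: T_def T'_def vec_eq_iff)
  then have blin: "bounded_linear T" "bounded_linear T'"
    by (simp_all add: linear_conv_bounded_linear)
  let ?g = "\<lambda>y. T (f (T' y))"
  have "negligible (?g ` T ` S)"
  proof (rule baby_Sard)
    fix y assume "y \<in> T ` S"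
    then have y: "T' y \<in> S" by auto
    show g: "(?g has_derivative (\<lambda>h. T (f' (T' y) (T' h)))) (at y within T ` S)"
      by (rule has_derivative_at_withinI, rule bounded_linear.has_derivative[OF blin(1)])
        (rule has_derivative_compose[OF bounded_linear_imp_has_derivative[OF blin(2)] der[OF y]])
    have glin: "linear (\<lambda>h. T (f' (T' y) (T' h)))"
      by (rule has_derivative_linear[OF g])
    obtain v where v: "v \<noteq> 0" "f' (T' y) v = 0" using sing[OF y] by blast
    have "T v \<noteq> 0" using v(1) T'T linear_0[OF lin(2)] by metis
    moreover have "matrix (\<lambda>h. T (f' (T' y) (T' h))) *v T v = 0"
      using matrix_works[OF glin[folded linear_matrix_vector_mul_eq]] by (simp add: v linear_0[OF lin(1)])
    ultimately have "rank (matrix (\<lambda>h. T (f' (T' y) (T' h)))) \<noteq> CARD('n ordered)"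
      using matrix_nonfull_linear_equations_eq by blast
    then show "rank (matrix (\<lambda>h. T (f' (T' y) (T' h)))) < CARD('n ordered)"
      using rank_bound[of "matrix (\<lambda>h. T (f' (T' y) (T' h)))"] by simp
  qed simp
  then have "negligible (T' ` ?g ` T ` S)"
    by (rule negligible_differentiable_image_negligible[rotated])
      (simp_all add: card_ordered linear_imp_differentiable_on lin)
  then show ?thesis by (simp add: image_image)
qed

section \<open>Open and dense regularity conditions\<close>

text \<open>With \<open>v = 0\<close> this says that the partial derivatives in \<open>J\<close> have no common zero; with unit
  vectors \<open>v\<close>, that at such a zero no \<open>v\<close> lies in the kernel of the Hessian rows in \<open>J\<close>. Quantifying
  over a compact \<open>K\<close> of pairs makes both conditions open by one argument.\<close>

definition nonvanishing_on :: "'n set \<Rightarrow> ((real ^ 'n) \<times> (real ^ 'n)) set \<Rightarrow> (real ^ 'n \<Rightarrow> real) \<Rightarrow> bool" where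
  "nonvanishing_on J K f \<longleftrightarrow> (\<forall>(x, v)\<in>K. \<exists>i\<in>J. partial i f x \<noteq> 0 \<or>
     (\<Sum>j\<in>UNIV. v $ j * partial j (partial i f) x) \<noteq> 0)"

text \<open>The condition at \<open>p\<close> amounts to positivity of a continuous function
  \<open>\<Phi> f\<close>, which has a positive lower bound on the compact \<open>K\<close>. A
  uniform C2-small change of \<open>f\<close> moves it by less than that bound, so a constant
  \<epsilon> suffices.\<close>

lemma openin_nonvanishing_on:
  fixes K :: "((real ^ 'n) \<times> (real ^ 'n)) set"
  assumes K: "compact K"
  shows "openin C2s_topology {f \<in> C2. nonvanishing_on J K f}"
  unfolding openin_C2s_topology
proof (intro conjI ballI)
  fix f :: "real ^ 'n \<Rightarrow> real"
  assume "f \<in> {f \<in> C2. nonvanishing_on J K f}"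
  then have f: "f \<in> C2" and nv: "nonvanishing_on J K f" by auto
  define \<Phi> where "\<Phi> g p = (\<Sum>i\<in>J. \<bar>partial i g (fst p)\<bar> +
    \<bar>\<Sum>j\<in>UNIV. snd p $ j * partial j (partial i g) (fst p)\<bar>)"
    for g :: "real ^ 'n \<Rightarrow> real" and p :: "(real ^ 'n) \<times> (real ^ 'n)"
  \<comment> \<open>\<open>\<epsilon> * L p\<close> bounds the change of \<open>\<Phi>\<close> at
    \<open>p\<close> when all first and second partials change by at most \<epsilon>.\<close>
  define L where "L p = (\<Sum>i\<in>J. 1 + (\<Sum>j\<in>UNIV. \<bar>snd p $ j\<bar>))" for p :: "(real ^ 'n) \<times> (real ^ 'n)"
  have pos: "\<exists>i\<in>J. partial i g x \<noteq> 0 \<or> (\<Sum>j\<in>UNIV. v $ j * partial j (partial i g) x) \<noteq> 0"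
    if "\<Phi> g (x, v) > 0" for g x v
  proof (rule ccontr)
    assume "\<not> ?thesis"
    then have "\<Phi> g (x, v) = 0" unfolding \<Phi>_def by (intro sum.neutral) auto
    then show False using that by simp
  qed
  have pos': "\<Phi> f p > 0" if p: "p \<in> K" for p
  proof -
    obtain i where "i \<in> J" "partial i f (fst p) \<noteq> 0 \<or>
        (\<Sum>j\<in>UNIV. snd p $ j * partial j (partial i f) (fst p)) \<noteq> 0"
      using bspec[OF nv[unfolded nonvanishing_on_def] p] by (auto simp: case_prod_beta)
    then show ?thesis unfolding \<Phi>_def by (intro sum_pos2[of J i]) auto
  qed
  have cont: "continuous_on K (\<Phi> f)"
    unfolding \<Phi>_def
    by (intro continuous_intros continuous_on_compose2[OF C1_continuous_partial[OF C2_imp_C1[OF f], where S = UNIV]]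
        continuous_on_compose2[OF C1_continuous_partial[OF C2_partial[OF f], where S = UNIV]]) auto
  have contL: "continuous_on K L"
    unfolding L_def by (intro continuous_intros)
  obtain \<mu> where \<mu>: "\<mu> > 0" "\<And>p. p \<in> K \<Longrightarrow> \<mu> \<le> \<Phi> f p"
  proof (cases "K = {}")
    case False
    then obtain q where "q \<in> K" "\<And>p. p \<in> K \<Longrightarrow> \<Phi> f q \<le> \<Phi> f p"
      using continuous_attains_inf[OF K False cont] by blast
    then show ?thesis using that pos' by blast
  qed (use that[of 1] in auto)
  obtain M where M: "M > 0" "\<And>p. p \<in> K \<Longrightarrow> L p \<le> M"
  proof -
    have "bounded (L ` K)" using compact_continuous_image[OF contL K] by (rule compact_imp_bounded)
    then obtain M where "\<forall>y\<in>L ` K. \<bar>y\<bar> \<le> M" unfolding bounded_real by blast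
    then show ?thesis by (intro that[of "\<bar>M\<bar> + 1"]) force+
  qed
  \<comment> \<open>With this choice \<open>\<epsilon> * M\<close> is half of the minimum bound
    \<open>\<mu>\<close>, so \<open>\<Phi> g\<close> stays positive on \<open>K\<close>.\<close>
  define \<epsilon> where "\<epsilon> = \<mu> / (2 * M)"
  have \<epsilon>: "\<epsilon> > 0" "\<epsilon> * M < \<mu>" using \<mu>(1) M(1) by (simp_all add: \<epsilon>_def field_simps)
  have "C2s_nbhd (\<lambda>_. \<epsilon>) f \<subseteq> {f \<in> C2. nonvanishing_on J K f}"
  proof
    fix g assume g: "g \<in> C2s_nbhd (\<lambda>_. \<epsilon>) f"
    have "\<Phi> g (x, v) > 0" if p: "(x, v) \<in> K" for x v
    proof -
      have "\<Phi> f (x, v) \<le> (\<Sum>i\<in>J. (\<bar>partial i g x\<bar> + \<bar>\<Sum>j\<in>UNIV. v $ j * partial j (partial i g) x\<bar>)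
          + \<epsilon> * (1 + (\<Sum>j\<in>UNIV. \<bar>v $ j\<bar>)))"
        unfolding \<Phi>_def fst_conv snd_conv
      proof (rule sum_mono)
        fix i
        have 1: "\<bar>partial i g x - partial i f x\<bar> < \<epsilon>"
          and 2: "\<bar>partial j (partial i g) x - partial j (partial i f) x\<bar> < \<epsilon>" for j
          using g by (auto simp: C2s_nbhd_def)
        have "\<bar>(\<Sum>j\<in>UNIV. v $ j * partial j (partial i g) x) -
            (\<Sum>j\<in>UNIV. v $ j * partial j (partial i f) x)\<bar>
            = \<bar>\<Sum>j\<in>UNIV. v $ j * (partial j (partial i g) x - partial j (partial i f) x)\<bar>"
          by (simp add: sum_subtractf right_diff_distrib)
        also have "\<dots> \<le> (\<Sum>j\<in>UNIV. \<bar>v $ j\<bar> * \<epsilon>)"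
          by (rule order_trans[OF sum_abs sum_mono])
            (simp add: abs_mult mult_left_mono less_imp_le[OF 2])
        also have "\<dots> = \<epsilon> * (\<Sum>j\<in>UNIV. \<bar>v $ j\<bar>)"
          by (simp add: sum_distrib_left mult.commute)
        finally show "\<bar>partial i f x\<bar> + \<bar>\<Sum>j\<in>UNIV. v $ j * partial j (partial i f) x\<bar>
            \<le> (\<bar>partial i g x\<bar> + \<bar>\<Sum>j\<in>UNIV. v $ j * partial j (partial i g) x\<bar>)
              + \<epsilon> * (1 + (\<Sum>j\<in>UNIV. \<bar>v $ j\<bar>))"
          using 1 by (simp add: distrib_left)
      qed
      also have "\<dots> = \<Phi> g (x, v) + \<epsilon> * L (x, v)"
        by (simp add: \<Phi>_def L_def sum.distrib sum_distrib_left distrib_left mult.left_commute)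
      also have "\<dots> \<le> \<Phi> g (x, v) + \<epsilon> * M"
        using M(2)[OF p] \<epsilon>(1) by (simp add: mult_left_mono)
      finally show ?thesis using \<mu>(2)[OF p] \<epsilon>(2) by linarith
    qed
    then show "g \<in> {f \<in> C2. nonvanishing_on J K f}"
      using g pos by (auto simp: C2s_nbhd_def nonvanishing_on_def)
  qed
  then show "\<exists>\<epsilon>. continuous_on UNIV \<epsilon> \<and> (\<forall>x. 0 < \<epsilon> x) \<and> C2s_nbhd \<epsilon> f \<subseteq> {f \<in> C2. nonvanishing_on J K f}"
    using \<epsilon>(1) by (intro exI[of _ "\<lambda>_. \<epsilon>"]) simp
qed auto

text \<open>The linear form is multiplied by a bump function equal to 1 on the ball of radius
  \<open>r\<close>. The perturbation then has compact support, so one \<delta> works even if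
  \<epsilon> decays to 0 at infinity.\<close>

lemma C2_linear_perturbation:
  fixes f :: "real ^ 'n \<Rightarrow> real"
  assumes f: "f \<in> C2" and \<epsilon>: "continuous_on UNIV \<epsilon>" "\<And>x. \<epsilon> x > 0"
  obtains \<delta> where "\<delta> > 0"
    "\<And>c :: real ^ 'n. norm c < \<delta> \<Longrightarrow> \<exists>g \<in> C2s_nbhd \<epsilon> f. \<forall>x. norm x < r \<longrightarrow>
      (\<forall>i. partial i g x = partial i f x + c $ i) \<and>
      (\<forall>i j. partial j (partial i g) x = partial j (partial i f) x)"
proof -
  obtain \<beta> :: "real ^ 'n \<Rightarrow> real" and R where \<beta>: "\<beta> \<in> C2"
    "\<And>x. norm x < r \<Longrightarrow> \<beta> x = 1" "\<And>x. norm x > R \<Longrightarrow> \<beta> x = 0"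
    using C2_bump[of r] by metis
  define h where "h k x = x $ k * \<beta> x" for k and x :: "real ^ 'n"
  have h: "h k \<in> C2" for k unfolding h_def by (intro C2_mult C2_nth \<beta>)
  have open_out: "open {x :: real ^ 'n. norm x > R}" and open_in: "open {x :: real ^ 'n. norm x < r}"
    by (intro open_Collect_less continuous_intros)+
  have h0: "h k x = 0" if "norm x > R" for k x using that by (simp add: h_def \<beta>)
  have h1: "partial i (h k) x = 0" if "norm x > R" for k x i
    using partial_cong_open[OF open_out, of x "h k" "\<lambda>_. 0" i] that
    by (simp add: h0 partial_const)
  have h2: "partial j (partial i (h k)) x = 0" if "norm x > R" for k x i j
    using partial_cong_open[OF open_out, of x "partial i (h k)" "\<lambda>_. 0" j] that
    by (simp add: h1 partial_const)
  \<comment> \<open>\<open>M x\<close> dominates the values and all first and second partials of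
    every \<open>h k\<close> at \<open>x\<close>. It vanishes for \<open>norm x > R\<close>, so
    bounding \<open>M x / \<epsilon> x\<close> on a compact ball gives \<open>B\<close>
    globally.\<close>
  define M where "M x = (\<Sum>k\<in>UNIV. \<bar>h k x\<bar> + (\<Sum>i\<in>UNIV. \<bar>partial i (h k) x\<bar>) +
    (\<Sum>j\<in>UNIV. \<Sum>i\<in>UNIV. \<bar>partial j (partial i (h k)) x\<bar>))" for x
  have contM: "continuous_on S M" for S
    unfolding M_def by (intro continuous_intros C1_continuous C1_continuous_partial C2_partial C2_imp_C1 h)
  obtain B where B: "B > 0" "\<And>x. M x \<le> B * \<epsilon> x"
  proof -
    have "continuous_on (cball 0 R) (\<lambda>x. M x / \<epsilon> x)"
      using \<epsilon>(2) by (intro continuous_on_divide contM continuous_on_subset[OF \<epsilon>(1)]) (auto simp: less_imp_neq[symmetric])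
    then have "bounded ((\<lambda>x. M x / \<epsilon> x) ` cball 0 R)"
      by (intro compact_imp_bounded compact_continuous_image) simp_all
    then obtain b where b: "\<forall>y\<in>(\<lambda>x. M x / \<epsilon> x) ` cball 0 R. \<bar>y\<bar> \<le> b" unfolding bounded_real by blast
    show ?thesis
    proof (rule that[of "\<bar>b\<bar> + 1"])
      fix x
      show "M x \<le> (\<bar>b\<bar> + 1) * \<epsilon> x"
      proof (cases "norm x \<le> R")
        case True
        then have "\<bar>M x / \<epsilon> x\<bar> \<le> b" using bspec[OF b imageI] by simp
        then have "M x / \<epsilon> x \<le> \<bar>b\<bar> + 1" by linarith
        then show ?thesis using \<epsilon>(2)[of x] by (simp add: divide_le_eq)
      next
        case False
        then show ?thesis using less_imp_le[OF \<epsilon>(2)[of x]] by (simp add: M_def h0 h1 h2)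
      qed
    qed simp
  qed
  show ?thesis
  proof (rule that[of "1 / B"])
    fix c :: "real ^ 'n"
    assume c: "norm c < 1 / B"
    define g where "g x = f x + (\<Sum>k\<in>UNIV. c $ k * h k x)" for x
    have p: "(\<lambda>x. \<Sum>k\<in>UNIV. c $ k * h k x) \<in> C2"
      by (intro C2_sum C2_mult C2_const h)
    have g: "g \<in> C2" unfolding g_def by (intro C2_add f p)
    have pg: "partial i g = (\<lambda>x. partial i f x + (\<Sum>k\<in>UNIV. c $ k * partial i (h k) x))" for i
      unfolding g_def
      by (simp add: partial_add partial_sum partial_mult partial_const C1_sum C1_mult C1_const C2_imp_C1 f h)
    have ppg: "partial j (partial i g) =
        (\<lambda>x. partial j (partial i f) x + (\<Sum>k\<in>UNIV. c $ k * partial j (partial i (h k)) x))" for i j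
      unfolding pg
      by (simp add: partial_add partial_sum partial_mult partial_const C1_sum C1_mult C1_const C2_partial f h)
    \<comment> \<open>Each difference of \<open>g\<close> and \<open>f\<close>, of order 0, 1 or 2,
      is such a sum. It is at most \<open>norm c * M x\<close>, and \<open>norm c < 1 / B\<close>
      makes this smaller than \<open>\<epsilon> x\<close>.\<close>
    have bound: "\<bar>\<Sum>k\<in>UNIV. c $ k * a k\<bar> < \<epsilon> x"
      if a: "\<And>k. \<bar>a k\<bar> \<le> \<bar>h k x\<bar> + (\<Sum>i\<in>UNIV. \<bar>partial i (h k) x\<bar>) +
        (\<Sum>j\<in>UNIV. \<Sum>i\<in>UNIV. \<bar>partial j (partial i (h k)) x\<bar>)" for a :: "'n \<Rightarrow> real" and x
    proof -
      have "\<bar>\<Sum>k\<in>UNIV. c $ k * a k\<bar> \<le> (\<Sum>k\<in>UNIV. norm c * \<bar>a k\<bar>)"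
        by (rule order_trans[OF sum_abs sum_mono])
          (simp add: abs_mult mult_right_mono component_le_norm_cart)
      also have "\<dots> \<le> norm c * M x"
        unfolding M_def sum_distrib_left[symmetric] by (intro mult_left_mono sum_mono a) simp
      also have "\<dots> \<le> norm c * (B * \<epsilon> x)" by (rule mult_left_mono[OF B(2)]) simp
      also have "\<dots> < 1 / B * (B * \<epsilon> x)" using c B(1) \<epsilon>(2)[of x] by (intro mult_strict_right_mono) auto
      finally show ?thesis using B(1) by simp
    qed
    have s1: "\<bar>F i\<bar> \<le> (\<Sum>i\<in>UNIV. \<bar>F i\<bar>)" for F :: "'n \<Rightarrow> real" and i
      by (rule member_le_sum) simp_all
    have s2: "\<bar>F j i\<bar> \<le> (\<Sum>j\<in>UNIV. \<Sum>i\<in>UNIV. \<bar>F j i\<bar>)" for F :: "'n \<Rightarrow> 'n \<Rightarrow> real" and i j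
      by (rule order_trans[OF s1[of "F j" i]], rule member_le_sum[of j UNIV "\<lambda>j. \<Sum>i\<in>UNIV. \<bar>F j i\<bar>"])
        (simp_all add: sum_nonneg)
    have "\<bar>g x - f x\<bar> < \<epsilon> x" for x
      unfolding g_def by (simp, rule bound) (simp add: sum_nonneg)
    moreover have "\<bar>partial i g x - partial i f x\<bar> < \<epsilon> x" for i x
      unfolding pg by (simp, rule bound)
        (use s1[of "\<lambda>i. partial i (h _) x" i] in \<open>simp add: sum_nonneg add_increasing add_increasing2\<close>)
    moreover have "\<bar>partial j (partial i g) x - partial j (partial i f) x\<bar> < \<epsilon> x" for i j x
      unfolding ppg by (simp, rule bound)
        (use s2[of "\<lambda>j i. partial j (partial i (h _)) x" j i] in \<open>simp add: sum_nonneg add_increasing\<close>)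
    ultimately have nbhd: "g \<in> C2s_nbhd \<epsilon> f" using g by (simp add: C2s_nbhd_def)
    have d1: "partial i (h k) x = (if i = k then 1 else 0)" if "norm x < r" for i k x
      using partial_cong_open[OF open_in, of x "h k" "\<lambda>x. x $ k" i] that
      by (simp add: h_def \<beta>(2) partial_nth)
    have d2: "partial j (partial i (h k)) x = 0" if "norm x < r" for i j k x
      using partial_cong_open[OF open_in, of x "partial i (h k)" "\<lambda>x. if i = k then 1 else 0" j] that
      by (simp add: d1 partial_const)
    have "partial i g x = partial i f x + c $ i" if "norm x < r" for i x
      unfolding pg by (simp add: d1 that if_distrib cong: if_cong)
    moreover have "partial j (partial i g) x = partial j (partial i f) x" if "norm x < r" for i j x
      unfolding ppg by (simp add: d2 that)
    ultimately show "\<exists>g \<in> C2s_nbhd \<epsilon> f. \<forall>x. norm x < r \<longrightarrow>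
      (\<forall>i. partial i g x = partial i f x + c $ i) \<and>
      (\<forall>i j. partial j (partial i g) x = partial j (partial i f) x)"
      using nbhd by blast
  qed (use B in simp)
qed

section \<open>The regular functions: openness and density\<close>

lemma has_derivative_vec_lambda:
  fixes f :: "'n::finite \<Rightarrow> 'a::real_normed_vector \<Rightarrow> real"
  assumes "\<And>i. (f i has_derivative f' i) (at x)"
  shows "((\<lambda>x. \<chi> i. f i x) has_derivative (\<lambda>h. \<chi> i. f' i h)) (at x)"
  by (subst has_derivative_componentwise_within) (auto simp: Basis_vec_def inner_axis assms)

definition coord_subspace :: "'n set \<Rightarrow> (real ^ 'n) set" where
  "coord_subspace J = {x. \<forall>i. i \<notin> J \<longrightarrow> x $ i = 0}"

definition coord_hyperplanes :: "(real ^ 'n) set" where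
  "coord_hyperplanes = (\<Union>i. {x. x $ i = 0})"

text \<open>The sparsity level does not enter: all \<open>J\<close> are taken, so the same sets
  serve every \<open>s\<close>. By homogeneity unit vectors \<open>v\<close> detect any kernel, and
  they keep the set of pairs compact. For \<open>J = {}\<close> no unit vector remains and the
  condition holds vacuously.\<close>

definition regular_within :: "nat \<Rightarrow> (real ^ 'n \<Rightarrow> real) set" where
  "regular_within m = {f \<in> C2. nonvanishing_on UNIV ((coord_hyperplanes \<inter> cball 0 m) \<times> {0}) f} \<inter>
     (\<Inter>J. {f \<in> C2. nonvanishing_on J ((coord_subspace J \<inter> cball 0 m) \<times> (coord_subspace J \<inter> sphere 0 1)) f})"

lemma regular_within_gradient:
  assumes "f \<in> regular_within m" "x \<in> coord_hyperplanes" "norm x \<le> m"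
  shows "\<exists>i. partial i f x \<noteq> 0"
proof -
  have nv: "nonvanishing_on UNIV ((coord_hyperplanes \<inter> cball 0 m) \<times> {0}) f"
    using assms(1) by (simp add: regular_within_def)
  have "(x, 0) \<in> (coord_hyperplanes \<inter> cball 0 m) \<times> {0}" using assms by simp
  from bspec[OF nv[unfolded nonvanishing_on_def] this] show ?thesis by simp
qed

lemma regular_within_hessian:
  assumes "f \<in> regular_within m" "x \<in> coord_subspace J" "norm x \<le> m" "\<And>i. i \<in> J \<Longrightarrow> partial i f x = 0"
    and "v \<in> coord_subspace J" "norm v = 1"
  shows "\<exists>i\<in>J. (\<Sum>j\<in>UNIV. v $ j * partial j (partial i f) x) \<noteq> 0"
proof -
  have nv: "nonvanishing_on J ((coord_subspace J \<inter> cball 0 m) \<times> (coord_subspace J \<inter> sphere 0 1)) f"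
    using assms(1) by (simp add: regular_within_def)
  have "(x, v) \<in> (coord_subspace J \<inter> cball 0 m) \<times> (coord_subspace J \<inter> sphere 0 1)" using assms by simp
  from bspec[OF nv[unfolded nonvanishing_on_def] this] show ?thesis using assms(4) by auto
qed

lemma closed_coord_subspace: "closed (coord_subspace J)"
proof -
  have "coord_subspace J = (\<Inter>i\<in>-J. {x. x $ i = 0})" by (auto simp: coord_subspace_def)
  moreover have "closed {x :: real ^ 'a. x $ i = 0}" for i
    by (intro closed_Collect_eq continuous_intros)
  ultimately show ?thesis by auto
qed

lemma closed_coord_hyperplanes: "closed (coord_hyperplanes :: (real ^ 'n) set)"
  unfolding coord_hyperplanes_def
  by (intro closed_UN closed_Collect_eq continuous_intros ballI) simp

lemma negligible_coord_hyperplanes: "negligible (coord_hyperplanes :: (real ^ 'n) set)"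
  unfolding coord_hyperplanes_def
  by (intro negligible_Union) (auto simp: negligible_standard_hyperplane_cart)

lemma openin_regular_within: "openin C2s_topology (regular_within m :: (real ^ 'n \<Rightarrow> real) set)"
  unfolding regular_within_def
  by (intro openin_Int openin_INT2 openin_nonvanishing_on compact_Times closed_Int_compact
      closed_coord_subspace closed_coord_hyperplanes) simp_all

text \<open>Shifting the gradient by \<open>- b\<close> turns each violation by \<open>g\<close>
  into a statement about \<open>b\<close>: it is a value of the gradient of \<open>f\<close> on a
  coordinate hyperplane, or a critical value of some \<open>F J\<close>. Both kinds of
  \<open>b\<close> form null sets, so a small good \<open>b\<close> exists.\<close>

lemma regular_within_meets_nbhd:
  fixes f :: "real ^ 'n \<Rightarrow> real"
  assumes f: "f \<in> C2" and \<epsilon>: "continuous_on UNIV \<epsilon>" "\<And>x. \<epsilon> x > 0"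
  shows "\<exists>g \<in> C2s_nbhd \<epsilon> f. g \<in> regular_within m"
proof -
  \<comment> \<open>\<open>F J\<close> pads the map \<open>x \<mapsto> (partial i f x)\<^sub>i\<^sub>\<in>\<^sub>J\<close> on the subspace of \<open>J\<close> by the identity in the other
    coordinates, so that its critical values form a null set of the whole space.\<close>
  define P where "P J x = (\<chi> i. if i \<in> J then x $ i else 0)" for J and x :: "real ^ 'n"
  define F where "F J x = (\<chi> i. if i \<in> J then partial i f (P J x) else x $ i)" for J and x :: "real ^ 'n"
  define F' where "F' J x v = (\<chi> i. if i \<in> J then \<Sum>j\<in>UNIV. P J v $ j * partial j (partial i f) (P J x) else v $ i)"
    for J and x v :: "real ^ 'n"
  define N where "N J = F J ` {x. \<exists>v. v \<noteq> 0 \<and> F' J x v = 0}" for J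
  define N0 where "N0 = (\<lambda>x. \<chi> i. partial i f x) ` coord_hyperplanes"
  have linP: "bounded_linear (P J)" for J
    unfolding linear_conv_bounded_linear[symmetric]
    by (auto intro!: linearI simp: P_def vec_eq_iff)
  have derF: "(F J has_derivative F' J x) (at x)" for J x
    unfolding F_def F'_def
  proof (rule has_derivative_vec_lambda)
    fix i
    show "((\<lambda>x. if i \<in> J then partial i f (P J x) else x $ i) has_derivative
        (\<lambda>v. if i \<in> J then \<Sum>j\<in>UNIV. P J v $ j * partial j (partial i f) (P J x) else v $ i)) (at x)"
      using has_derivative_compose[OF bounded_linear_imp_has_derivative[OF linP[of J]]
          C1_has_derivative[OF C2_partial[OF f, of i]], of x UNIV]
        bounded_linear_imp_has_derivative[OF bounded_linear_vec_nth, of i "at x"]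
      by (cases "i \<in> J") simp_all
  qed
  have "negligible (N J)" for J
    unfolding N_def by (rule negligible_critical_values[OF derF]) simp
  \<comment> \<open>The gradient of a \<open>C2\<close> function is differentiable, and
    differentiable maps between spaces of equal dimension preserve null sets.\<close>
  moreover have "negligible N0"
    unfolding N0_def
  proof (rule negligible_differentiable_image_negligible[OF order_refl negligible_coord_hyperplanes])
    have "((\<lambda>x. \<chi> i. partial i f x) has_derivative
        (\<lambda>v. \<chi> i. \<Sum>j\<in>UNIV. v $ j * partial j (partial i f) x)) (at x)" for x
      by (rule has_derivative_vec_lambda) (rule C1_has_derivative[OF C2_partial[OF f]])
    then show "(\<lambda>x. \<chi> i. partial i f x) differentiable_on coord_hyperplanes"
      unfolding differentiable_on_def differentiable_def
      by (meson has_derivative_at_withinI)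
  qed
  ultimately have neg: "negligible (N0 \<union> (\<Union>J. N J))"
    by (intro negligible_Un negligible_Union) auto
  \<comment> \<open>The shift is exact only on an open ball; radius \<open>m + 1\<close> makes it
    contain the closed ball of radius \<open>m\<close>.\<close>
  obtain \<delta> where \<delta>: "\<delta> > 0"
    and pert: "\<And>c :: real ^ 'n. norm c < \<delta> \<Longrightarrow> \<exists>g \<in> C2s_nbhd \<epsilon> f. \<forall>x. norm x < real m + 1 \<longrightarrow>
      (\<forall>i. partial i g x = partial i f x + c $ i) \<and>
      (\<forall>i j. partial j (partial i g) x = partial j (partial i f) x)"
    using C2_linear_perturbation[OF f \<epsilon>, of "real m + 1"] by metis
  have "\<not> ball 0 \<delta> \<subseteq> N0 \<union> (\<Union>J. N J)"
    using open_not_negligible[OF open_ball, of 0 \<delta>] \<delta> negligible_subset[OF neg] by auto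
  then obtain b where "b \<in> ball 0 \<delta>" "b \<notin> N0 \<union> (\<Union>J. N J)" by blast
  then have b: "norm b < \<delta>" "b \<notin> N0" "\<And>J. b \<notin> N J" by simp_all
  then obtain g where g: "g \<in> C2s_nbhd \<epsilon> f" "\<And>x i. norm x < real m + 1 \<Longrightarrow> partial i g x = partial i f x - b $ i"
    "\<And>x i j. norm x < real m + 1 \<Longrightarrow> partial j (partial i g) x = partial j (partial i f) x"
    using pert[of "- b"] by auto
  have "\<exists>i. partial i g x \<noteq> 0" if x: "x \<in> coord_hyperplanes" "norm x \<le> m" for x
  proof (rule ccontr)
    assume "\<not> ?thesis"
    then have "b = (\<chi> i. partial i f x)" using g(2)[of x] x(2) by (simp add: vec_eq_iff)
    then show False using b(2) x(1) by (auto simp: N0_def)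
  qed
  moreover have "\<exists>i\<in>J. partial i g x \<noteq> 0 \<or> (\<Sum>j\<in>UNIV. v $ j * partial j (partial i g) x) \<noteq> 0"
    if x: "x \<in> coord_subspace J" "norm x \<le> m" and v: "v \<in> coord_subspace J" "norm v = 1" for J x v
  proof (rule ccontr)
    assume contra: "\<not> ?thesis"
    \<comment> \<open>Coordinates outside \<open>J\<close> are copied from \<open>b\<close>, so
      \<open>F J y\<close> agrees with \<open>b\<close> there. Inside \<open>J\<close>, the
      vanishing partials of \<open>g\<close> say that those of \<open>f\<close> equal the entries of
      \<open>b\<close>.\<close>
    define y where "y = (\<chi> i. if i \<in> J then x $ i else b $ i)"
    have Py: "P J y = x" and Pv: "P J v = v"
      using x(1) v(1) by (auto simp: P_def y_def coord_subspace_def vec_eq_iff)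
    have "F J y = b"
      using contra g(2)[of x] x(2) unfolding F_def Py by (auto simp: vec_eq_iff y_def)
    moreover have "F' J y v = 0"
      using contra g(3)[of x] x(2) v(1) unfolding F'_def Py Pv
      by (auto simp: vec_eq_iff coord_subspace_def)
    moreover have "v \<noteq> 0" using v(2) by auto
    ultimately show False using b(3)[of J] unfolding N_def by blast
  qed
  ultimately have "g \<in> regular_within m"
    using g(1) by (auto simp: regular_within_def nonvanishing_on_def C2s_nbhd_def)
  then show ?thesis using g(1) by blast
qed

lemma dense_regular_within:
  "C2s_topology closure_of (regular_within m :: (real ^ 'n \<Rightarrow> real) set) = topspace C2s_topology"
proof (rule antisym[OF closure_of_subset_topspace])
  show "topspace C2s_topology \<subseteq> C2s_topology closure_of (regular_within m :: (real ^ 'n \<Rightarrow> real) set)"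
    unfolding subset_iff in_closure_of topspace_C2s_topology
  proof (intro allI impI conjI)
    fix f :: "real ^ 'n \<Rightarrow> real" and T
    assume f: "f \<in> C2" and T: "f \<in> T \<and> openin C2s_topology T"
    then obtain \<epsilon> where "continuous_on UNIV \<epsilon>" "\<forall>x. 0 < \<epsilon> x" "C2s_nbhd \<epsilon> f \<subseteq> T"
      unfolding openin_C2s_topology by blast
    then show "\<exists>y. y \<in> regular_within m \<and> y \<in> T"
      using regular_within_meets_nbhd[OF f, of \<epsilon> m] by blast
  qed
qed

section \<open>Local minimizers\<close>

text \<open>Since the whole line through \<open>x\<close> lies in \<open>S\<close>, both signs of
  \<open>t\<close> are allowed and \<open>\<phi>\<close> has an ordinary local minimum at 0; the
  one-variable necessary conditions apply.\<close>

lemma local_minimizer_on_second_order: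
  fixes f :: "real ^ 'n \<Rightarrow> real"
  assumes f: "f \<in> C2" and min: "local_minimizer_on f S x"
    and line: "\<And>t. x + t *\<^sub>R v \<in> S"
  shows "(\<Sum>i\<in>UNIV. v $ i * partial i f x) = 0"
    and "(\<Sum>i\<in>UNIV. \<Sum>j\<in>UNIV. v $ i * v $ j * partial j (partial i f) x) \<ge> 0"
proof -
  define \<phi> where "\<phi> t = f (x + t *\<^sub>R v)" for t
  define \<phi>' where "\<phi>' t = (\<Sum>i\<in>UNIV. v $ i * partial i f (x + t *\<^sub>R v))" for t
  define d where "d = (\<Sum>i\<in>UNIV. \<Sum>j\<in>UNIV. v $ i * v $ j * partial j (partial i f) x)"
  have der: "((\<lambda>t. h (x + t *\<^sub>R v)) has_real_derivative (\<Sum>i\<in>UNIV. v $ i * partial i h (x + t *\<^sub>R v))) (at t)"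
    if "h \<in> C1" for h t
  proof -
    have "((\<lambda>t. x + t *\<^sub>R v) has_derivative (\<lambda>s. s *\<^sub>R v)) (at t)"
      by (auto intro!: derivative_eq_intros)
    from has_derivative_compose[OF this C1_has_derivative[OF that]]
    have "((\<lambda>t. h (x + t *\<^sub>R v)) has_derivative
        (\<lambda>s. \<Sum>i\<in>UNIV. (s *\<^sub>R v) $ i * partial i h (x + t *\<^sub>R v))) (at t)" .
    then show ?thesis
      unfolding has_field_derivative_def
      by (rule has_derivative_eq_rhs) (simp add: sum_distrib_left sum_distrib_right mult_ac fun_eq_iff)
  qed
  have d1: "(\<phi> has_real_derivative \<phi>' t) (at t)" for t
    unfolding \<phi>_def \<phi>'_def by (rule der[OF C2_imp_C1[OF f]])
  have d2: "(\<phi>' has_real_derivative d) (at 0)"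
  proof -
    have "(\<phi>' has_real_derivative (\<Sum>i\<in>UNIV. v $ i * (\<Sum>j\<in>UNIV. v $ j * partial j (partial i f) (x + 0 *\<^sub>R v)))) (at 0)"
      unfolding \<phi>'_def by (intro DERIV_sum DERIV_cmult der C2_partial f)
    then show ?thesis by (simp add: d_def sum_distrib_left mult.assoc)
  qed
  obtain U where U: "open U" "x \<in> U" "\<And>y. y \<in> S \<inter> U \<Longrightarrow> f x \<le> f y"
    using min unfolding local_minimizer_on_def by blast
  have "open ((\<lambda>t. x + t *\<^sub>R v) -` U)"
    by (intro open_vimage U continuous_intros)
  moreover have "0 \<in> (\<lambda>t::real. x + t *\<^sub>R v) -` U" using U(2) by simp
  ultimately obtain e where "e > 0" "ball 0 e \<subseteq> (\<lambda>t. x + t *\<^sub>R v) -` U"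
    by (rule openE)
  then have e: "e > 0" "\<And>t. \<bar>t\<bar> < e \<Longrightarrow> x + t *\<^sub>R v \<in> U"
    by (auto simp: subset_iff)
  have min\<phi>: "\<phi> 0 \<le> \<phi> t" if "\<bar>t\<bar> < e" for t
    using U(3) e(2)[OF that] line by (simp add: \<phi>_def)
  have \<phi>'0: "\<phi>' 0 = 0"
    by (rule DERIV_local_min[OF d1 e(1)]) (simp add: min\<phi>)
  then show "(\<Sum>i\<in>UNIV. v $ i * partial i f x) = 0" by (simp add: \<phi>'_def)
  \<comment> \<open>As \<open>\<phi>' 0 = 0\<close>, a negative \<open>d\<close> would make
    \<open>\<phi>'\<close> negative just to the right of 0, and \<open>\<phi>\<close> would drop
    below \<open>\<phi> 0\<close> inside the radius \<open>e\<close> of minimality.\<close>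
  have "d \<ge> 0"
  proof (rule ccontr)
    assume "\<not> d \<ge> 0"
    then obtain a where a: "a > 0" "\<And>h. h > 0 \<Longrightarrow> h < a \<Longrightarrow> \<phi>' h < 0"
      using DERIV_neg_dec_right[OF d2] \<phi>'0 by auto
    define t where "t = min a e / 2"
    have t: "0 < t" "t < a" "\<bar>t\<bar> < e" using a(1) e(1) by (auto simp: t_def)
    have "\<phi> t < \<phi> 0"
    proof (rule DERIV_neg_imp_decreasing_open[OF t(1)])
      show "\<exists>y. (\<phi> has_real_derivative y) (at s) \<and> y < 0" if "0 < s" "s < t" for s
        using d1 a(2)[of s] that t(2) by (intro exI[of _ "\<phi>' s"]) auto
      show "continuous_on {0..t} \<phi>"
        by (intro continuous_at_imp_continuous_on ballI DERIV_isCont[OF d1])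
    qed
    then show False using min\<phi>[OF t(3)] by simp
  qed
  then show "(\<Sum>i\<in>UNIV. \<Sum>j\<in>UNIV. v $ i * v $ j * partial j (partial i f) x) \<ge> 0"
    unfolding d_def .
qed

section \<open>The Hessian block as a form on the coordinate subspace\<close>

definition extend_I1 :: "real ^ 'n \<Rightarrow> real Matrix.vec \<Rightarrow> real ^ 'n" where
  "extend_I1 x w = (\<chi> i. \<Sum>a<norm0 x. if enum_I1 x ! a = i then Matrix.vec_index w a else 0)"

lemma extend_I1_nth:
  assumes "a < norm0 x"
  shows "extend_I1 x w $ (enum_I1 x ! a) = Matrix.vec_index w a"
proof -
  have "(\<Sum>b<norm0 x. if enum_I1 x ! b = enum_I1 x ! a then Matrix.vec_index w b else 0)
      = (\<Sum>b<norm0 x. if b = a then Matrix.vec_index w b else 0)"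
    using assms by (intro sum.cong) (auto simp: nth_eq_iff_index_eq enum_I1 length_enum_I1)
  then show ?thesis using assms by (simp add: extend_I1_def)
qed

lemma extend_I1_in_coord_subspace: "extend_I1 x w \<in> coord_subspace (I1 x)"
proof -
  have "enum_I1 x ! a \<in> I1 x" if "a < norm0 x" for a
    using that nth_mem[of a "enum_I1 x"] by (simp add: enum_I1 length_enum_I1)
  then show ?thesis by (auto simp: coord_subspace_def extend_I1_def intro!: sum.neutral)
qed

text \<open>This is the bridge from sums over all coordinates to matrix-vector products: the zero
  extension removes the terms off the support, and the enumeration reindexes the others.\<close>

lemma sum_extend_I1:
  "(\<Sum>j\<in>UNIV. extend_I1 x w $ j * h j) = (\<Sum>a<norm0 x. Matrix.vec_index w a * h (enum_I1 x ! a))"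
proof -
  have "(\<Sum>j\<in>UNIV. extend_I1 x w $ j * h j) = (\<Sum>j\<in>I1 x. extend_I1 x w $ j * h j)"
    using extend_I1_in_coord_subspace[of x w]
    by (intro sum.mono_neutral_right) (auto simp: coord_subspace_def)
  also have "\<dots> = (\<Sum>a<norm0 x. extend_I1 x w $ (enum_I1 x ! a) * h (enum_I1 x ! a))"
    by (rule sum.reindex_bij_betw[symmetric])
      (rule bij_betw_nth[OF enum_I1(1)], simp_all add: enum_I1 length_enum_I1)
  finally show ?thesis by (simp add: extend_I1_nth)
qed

lemma extend_I1_eq_0_iff:
  assumes "w \<in> carrier_vec (norm0 x)"
  shows "extend_I1 x w = 0 \<longleftrightarrow> w = 0\<^sub>v (norm0 x)"
proof
  assume "extend_I1 x w = 0"
  then show "w = 0\<^sub>v (norm0 x)"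
    using extend_I1_nth[of _ x w] assms by (intro eq_vecI) auto
qed (auto simp: extend_I1_def vec_eq_iff intro!: sum.neutral)

lemma hessian_I1_carrier: "hessian_I1 f x \<in> carrier_mat (norm0 x) (norm0 x)"
  by (simp add: hessian_I1_def)

text \<open>A kernel vector of a singular block, extended by zero and normalised, would contradict
  \<open>nv\<close>.\<close>

lemma det_hessian_I1_nonzero:
  fixes f :: "real ^ 'n \<Rightarrow> real"
  assumes nv: "\<And>v. v \<in> coord_subspace (I1 x) \<Longrightarrow> norm v = 1 \<Longrightarrow>
    \<exists>i\<in>I1 x. (\<Sum>j\<in>UNIV. v $ j * partial j (partial i f) x) \<noteq> 0"
  shows "Determinant.det (hessian_I1 f x) \<noteq> 0"
proof
  \<comment> \<open>In \<open>nv\<close> the row index is the inner derivative, whereas in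
    \<open>hessian_I1\<close> it is the outer one. Passing to the transpose reconciles them without
    appeal to the symmetry of second derivatives.\<close>
  let ?A = "transpose_mat (hessian_I1 f x)"
  have A: "?A \<in> carrier_mat (norm0 x) (norm0 x)"
    using hessian_I1_carrier by simp
  assume "Determinant.det (hessian_I1 f x) = 0"
  then have "Determinant.det ?A = 0"
    by (simp add: Determinant.det_transpose[OF hessian_I1_carrier])
  then obtain w where w: "w \<in> carrier_vec (norm0 x)" "w \<noteq> 0\<^sub>v (norm0 x)" "?A *\<^sub>v w = 0\<^sub>v (norm0 x)"
    unfolding det_0_iff_vec_prod_zero_field[OF A] by blast
  let ?u = "extend_I1 x w"
  define v where "v = (1 / norm ?u) *\<^sub>R ?u"
  have "?u \<noteq> 0" using w extend_I1_eq_0_iff by blast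
  then have "norm v = 1" by (simp add: v_def)
  moreover have "v \<in> coord_subspace (I1 x)"
    using extend_I1_in_coord_subspace[of x w] by (simp add: v_def coord_subspace_def)
  ultimately obtain i where i: "i \<in> I1 x" "(\<Sum>j\<in>UNIV. v $ j * partial j (partial i f) x) \<noteq> 0"
    using nv by blast
  obtain b where b: "b < norm0 x" "i = enum_I1 x ! b"
    using i(1) by (metis enum_I1(2) in_set_conv_nth length_enum_I1)
  have "(\<Sum>j\<in>UNIV. v $ j * partial j (partial i f) x)
      = 1 / norm ?u * (\<Sum>j\<in>UNIV. ?u $ j * partial j (partial i f) x)"
    by (simp add: v_def sum_distrib_left mult.assoc)
  also have "(\<Sum>j\<in>UNIV. ?u $ j * partial j (partial i f) x) = Matrix.vec_index (?A *\<^sub>v w) b"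
    using b w(1) by (simp add: sum_extend_I1 hessian_I1_def scalar_prod_def lessThan_atLeast0 mult.commute)
  also have "\<dots> = 0" using b w(3) by simp
  finally show False using i(2) by simp
qed

text \<open>At the zero extension of an eigenvector the form equals its eigenvalue times a positive
  sum of squares, so \<open>psd\<close> excludes negative eigenvalues and the sum defining the index
  is empty.\<close>

lemma quadratic_index_eq_0:
  fixes f :: "real ^ 'n \<Rightarrow> real"
  assumes psd: "\<And>v. v \<in> coord_subspace (I1 x) \<Longrightarrow>
    (\<Sum>i\<in>UNIV. \<Sum>j\<in>UNIV. v $ i * v $ j * partial j (partial i f) x) \<ge> 0"
  shows "quadratic_index f x = 0"
proof -
  have False if neg: "\<mu> < 0" and ev: "eigenvalue (hessian_I1 f x) \<mu>" for \<mu>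
  proof -
    obtain w where w: "w \<in> carrier_vec (norm0 x)" "w \<noteq> 0\<^sub>v (norm0 x)" "hessian_I1 f x *\<^sub>v w = \<mu> \<cdot>\<^sub>v w"
      using ev hessian_I1_carrier[of f x] unfolding eigenvalue_def eigenvector_def by auto
    let ?u = "extend_I1 x w"
    have Hw: "(\<Sum>i\<in>UNIV. ?u $ i * partial (enum_I1 x ! a) (partial i f) x) = \<mu> * Matrix.vec_index w a"
      if "a < norm0 x" for a
    proof -
      have "(\<Sum>i\<in>UNIV. ?u $ i * partial (enum_I1 x ! a) (partial i f) x)
          = Matrix.vec_index (hessian_I1 f x *\<^sub>v w) a"
        using that w(1) by (simp add: sum_extend_I1 hessian_I1_def scalar_prod_def lessThan_atLeast0 mult.commute)
      then show ?thesis using that w by simp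
    qed
    \<comment> \<open>After the swap the outer derivative indexes the rows, as in
      \<open>hessian_I1\<close>, so that \<open>Hw\<close> can be inserted.\<close>
    have "(\<Sum>i\<in>UNIV. \<Sum>j\<in>UNIV. ?u $ i * ?u $ j * partial j (partial i f) x)
        = (\<Sum>j\<in>UNIV. ?u $ j * (\<Sum>i\<in>UNIV. ?u $ i * partial j (partial i f) x))"
      by (subst sum.swap) (simp add: sum_distrib_left mult_ac)
    also have "\<dots> = (\<Sum>a<norm0 x. Matrix.vec_index w a * (\<mu> * Matrix.vec_index w a))"
      by (simp add: sum_extend_I1[of x w "\<lambda>j. \<Sum>i\<in>UNIV. ?u $ i * partial j (partial i f) x"] Hw)
    also have "\<dots> = \<mu> * (\<Sum>a<norm0 x. (Matrix.vec_index w a)\<^sup>2)"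
      by (simp add: sum_distrib_left power2_eq_square mult_ac)
    finally have "\<mu> * (\<Sum>a<norm0 x. (Matrix.vec_index w a)\<^sup>2) \<ge> 0"
      using psd[OF extend_I1_in_coord_subspace[of x w]] by simp
    then have "(\<Sum>a<norm0 x. (Matrix.vec_index w a)\<^sup>2) \<le> 0"
      using neg by (simp add: zero_le_mult_iff)
    then have "(\<Sum>a<norm0 x. (Matrix.vec_index w a)\<^sup>2) = 0"
      by (intro antisym sum_nonneg) simp_all
    then have "\<forall>a<norm0 x. Matrix.vec_index w a = 0" by (simp add: sum_nonneg_eq_0_iff)
    then have "w = 0\<^sub>v (norm0 x)" using w(1) by (intro eq_vecI) auto
    then show False using w(2) by simp
  qed
  then have "{\<mu>. \<mu> < 0 \<and> eigenvalue (hessian_I1 f x) \<mu>} = {}" by blast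
  then show ?thesis unfolding quadratic_index_def by (simp only: sum.empty)
qed

lemma local_minimizer_nondegenerate:
  fixes x :: "real ^ 'n"
  assumes s: "s < CARD('n)" and f: "\<And>m. f \<in> regular_within m"
    and min: "local_minimizer_on f (sparse_vectors s) x"
  shows "nondegenerate_M_stationary f s x \<and> M_index f s x = 0"
proof -
  have fC2: "f \<in> C2" using f[of 0] by (simp add: regular_within_def)
  obtain m :: nat where m: "norm x \<le> m" using real_arch_simple by blast
  have x: "norm0 x \<le> s" using min by (simp add: local_minimizer_on_def sparse_vectors_def)
  \<comment> \<open>Moving along \<open>v\<close> changes no coordinate outside the two supports, so
    this bound keeps the whole line inside the sparse vectors.\<close>
  have second: "(\<Sum>i\<in>UNIV. v $ i * partial i f x) = 0"
    "(\<Sum>i\<in>UNIV. \<Sum>j\<in>UNIV. v $ i * v $ j * partial j (partial i f) x) \<ge> 0"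
    if v: "card (I1 x \<union> I1 v) \<le> s" for v
  proof -
    have "x + t *\<^sub>R v \<in> sparse_vectors s" for t
    proof -
      have "{i. (x + t *\<^sub>R v) $ i \<noteq> 0} \<subseteq> I1 x \<union> I1 v" by (auto simp: I1_def)
      then have "norm0 (x + t *\<^sub>R v) \<le> card (I1 x \<union> I1 v)"
        unfolding norm0_def by (intro card_mono) auto
      then show ?thesis using v by (simp add: sparse_vectors_def)
    qed
    from local_minimizer_on_second_order[OF fC2 min this]
    show "(\<Sum>i\<in>UNIV. v $ i * partial i f x) = 0"
      "(\<Sum>i\<in>UNIV. \<Sum>j\<in>UNIV. v $ i * v $ j * partial j (partial i f) x) \<ge> 0" .
  qed
  \<comment> \<open>This covers two cases at once: \<open>i\<close> in the support, where the
    insertion changes nothing, and arbitrary \<open>i\<close> when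
    \<open>norm0 x < s\<close>.\<close>
  have crit: "partial i f x = 0" if "card (insert i (I1 x)) \<le> s" for i
  proof -
    have "I1 (axis i 1 :: real ^ 'n) = {i}" by (auto simp: I1_def axis_def)
    then have "(\<Sum>j\<in>UNIV. axis i 1 $ j * partial j f x) = 0"
      using that by (intro second) simp
    moreover have "(\<Sum>j\<in>UNIV. axis i 1 $ j * partial j f x) = (\<Sum>j\<in>UNIV. if j = i then partial j f x else 0)"
      by (rule sum.cong) (auto simp: axis_def)
    ultimately show ?thesis by simp
  qed
  have card_I1: "card (I1 x) = norm0 x" by (simp add: norm0_def I1_def)
  have eq: "norm0 x = s"
  proof (rule ccontr)
    assume "norm0 x \<noteq> s"
    then have "partial i f x = 0" for i
      using x card_insert_le_m1[of s "I1 x" i] card_I1 by (intro crit) linarith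
    moreover have "x \<in> coord_hyperplanes"
    proof -
      have "I1 x \<noteq> UNIV" using card_I1 x s by auto
      then show ?thesis by (auto simp: I1_def coord_hyperplanes_def)
    qed
    ultimately show False
      using regular_within_gradient[OF f _ m] by simp
  qed
  have stat: "partial i f x = 0" if "i \<in> I1 x" for i
    using that eq card_I1 by (intro crit) (simp add: insert_absorb)
  have "x \<in> coord_subspace (I1 x)" by (simp add: coord_subspace_def I1_def)
  then have "Determinant.det (hessian_I1 f x) \<noteq> 0"
    by (intro det_hessian_I1_nonzero regular_within_hessian[OF f _ m] stat)
  moreover have "quadratic_index f x = 0"
  proof (rule quadratic_index_eq_0, rule second(2))
    fix v assume "v \<in> coord_subspace (I1 x)"
    then have "I1 x \<union> I1 v = I1 x" by (auto simp: coord_subspace_def I1_def)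
    then show "card (I1 x \<union> I1 v) \<le> s" using eq card_I1 by simp
  qed
  \<comment> \<open>With \<open>norm0 x = s\<close>, ND1 is vacuous and the term
    \<open>s - norm0 x\<close> of the M-index is 0.\<close>
  ultimately show ?thesis
    using eq stat
    by (simp add: nondegenerate_M_stationary_def M_stationary_def M_index_def sparse_vectors_def)
qed

theorem theorem3:
  fixes s :: nat
  assumes "s < CARD('n::finite)"
  shows "generic_in C2s_topology
    {f \<in> C2. \<forall>x :: real ^ 'n. local_minimizer_on f (sparse_vectors s) x \<longrightarrow>
        nondegenerate_M_stationary f s x \<and> M_index f s x = 0}"
  unfolding generic_in_def topspace_C2s_topology
proof (intro conjI exI[of _ regular_within] allI)
  \<comment> \<open>Membership for all \<open>m\<close> gives regularity on balls of every radius,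
    hence at each minimizer wherever it lies.\<close>
  show "(\<Inter>m. regular_within m) \<subseteq> {f \<in> C2. \<forall>x :: real ^ 'n. local_minimizer_on f (sparse_vectors s) x \<longrightarrow>
        nondegenerate_M_stationary f s x \<and> M_index f s x = 0}"
    using local_minimizer_nondegenerate[OF assms] by (auto simp: regular_within_def)
qed (auto simp: openin_regular_within dense_regular_within[unfolded topspace_C2s_topology])

end
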